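(* Consider an instance of monotone covering (defined in the context) and run the greedy algorithm on it. Suppose that in every call $\mathrm{step}(x,S)$ the step size is chosen with $\beta \le \mathrm{distance}_c(x,S)$ (for the current $x$), and suppose the algorithm terminates. Then the returned $x$ is feasible and satisfies $c(x)\le \Delta\cdot \mathrm{OPT}$.
   Context: A monotone covering instance consists of a collection $\mathcal C$ of subsets of $\mathbb R_+^n$, each monotone (closed upwards: if $x\in S$ and $y\ge x$ componentwise then $y\in S$; the sets need not be convex), and a cost function $c:\mathbb R_+^n\to\mathbb R_+$ that is non-decreasing and submodular, i.e. $c(x)+c(y)\ge c(x\wedge y)+c(x\vee y)$ for all $x,y$, where $\wedge,\vee$ denote componentwise minimum and maximum. A vector $x\in\mathbb R_+^n$ is feasible if $x\in S$ for all $S\in\mathcal C$; $\mathrm{OPT}$ is the infimum of $c(x)$ over feasible $x$. For $S\in\mathcal C$, $\mathrm{vars}(S)$ is the set of coordinates on which membership in $S$ depends, and $\Delta=\max_{S\in\mathcal C}|\mathrm{vars}(S)|$. For $x\in\mathbb R_+^n$ and $S\in\mathcal C$, $\mathrm{distance}_c(x,S)=\inf\{c(\hat x)-c(x):\hat x\in S,\ \hat x\ge x\}$. The greedy algorithm: start with $x=\mathbf 0$; while some $S\in\mathcal C$ has $x\notin S$, pick any such $S$ and perform $\mathrm{step}(x,S)$: choose a step size $\beta\ge 0$; for each $j\in\mathrm{vars}(S)$ let $x'_j\in\mathbb R_+\cup\{\infty\}$ be the largest value such that raising only coordinate $x_j$ (all other coordinates of the current $x$ fixed) to $x'_j$ would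 increase $c(x)$ by at most $\beta$; then simultaneously set $x_j\leftarrow x'_j$ for all $j\in\mathrm{vars}(S)$. When all constraints are satisfied, return $x$.
   Formalization: The formal theorem additionally assumes that the cost c is continuous on the nonnegative orthant, and that Δ > 0 or c(0) = 0; without either assumption the stated bound c(x) ≤ Δ·OPT can fail. *)

theory Defs
  imports "HOL-Analysis.Analysis"
begin

definition monotone_constraint :: "(real ^ 'n) set \<Rightarrow> bool" where
  "monotone_constraint S \<longleftrightarrow>
     S \<subseteq> {x. 0 \<le> x} \<and> (\<forall>x y. x \<in> S \<longrightarrow> x \<le> y \<longrightarrow> y \<in> S)"

definition nondecreasing_cost :: "(real ^ 'n \<Rightarrow> real) \<Rightarrow> bool" where
  "nondecreasing_cost c \<longleftrightarrow> (\<forall>x y. 0 \<le> x \<longrightarrow> x \<le> y \<longrightarrow> c x \<le> c y)"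

definition submodular_cost :: "(real ^ 'n \<Rightarrow> real) \<Rightarrow> bool" where
  "submodular_cost c \<longleftrightarrow>
     (\<forall>x y. 0 \<le> x \<longrightarrow> 0 \<le> y \<longrightarrow> c (inf x y) + c (sup x y) \<le> c x + c y)"

text \<open>The cost is a function on the nonnegative orthant; its values elsewhere are irrelevant.\<close>

definition monotone_covering :: "(real ^ 'n) set set \<Rightarrow> (real ^ 'n \<Rightarrow> real) \<Rightarrow> bool" where
  "monotone_covering C c \<longleftrightarrow>
     (\<forall>S\<in>C. monotone_constraint S) \<and> (\<forall>x. 0 \<le> x \<longrightarrow> 0 \<le> c x) \<and>
     nondecreasing_cost c \<and> submodular_cost c"

definition feasible :: "(real ^ 'n) set set \<Rightarrow> real ^ 'n \<Rightarrow> bool" where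
  "feasible C x \<longleftrightarrow> 0 \<le> x \<and> (\<forall>S\<in>C. x \<in> S)"

text \<open>The infimum is \<open>\<infinity>\<close> when no feasible vector exists.\<close>

definition OPT :: "(real ^ 'n) set set \<Rightarrow> (real ^ 'n \<Rightarrow> real) \<Rightarrow> ennreal" where
  "OPT C c = (INF x\<in>{x. feasible C x}. ennreal (c x))"

definition vars :: "(real ^ 'n) set \<Rightarrow> 'n set" where
  "vars S = {j. \<exists>x y. 0 \<le> x \<and> 0 \<le> y \<and> (\<forall>i. i \<noteq> j \<longrightarrow> x $ i = y $ i) \<and> x \<in> S \<and> y \<notin> S}"

text \<open>The cardinalities are bounded by the dimension, so for a nonempty collection this supremum
  of naturals is a maximum, even if the collection is infinite; for the empty collection it is 0.\<close>

definition Delta :: "(real ^ 'n) set set \<Rightarrow> nat" where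
  "Delta C = (SUP S\<in>C. card (vars S))"

text \<open>A step may raise a coordinate to \<open>\<infinity>\<close>, so the iterates of the algorithm live in
  \<open>ennreal ^ 'n\<close>. Constraints and cost are extended to such vectors monotonically from below:
  \<open>u\<close> belongs to the extension of \<open>S\<close> if some real vector below \<open>u\<close> belongs to \<open>S\<close>, and the
  cost of \<open>u\<close> is the supremum of the costs of the real vectors below \<open>u\<close>. The lemmas after the
  definitions show that nothing changes on real vectors.\<close>

definition embed :: "real ^ 'n \<Rightarrow> ennreal ^ 'n" where
  "embed x = (\<chi> j. ennreal (x $ j))"

definition ext_set :: "(real ^ 'n) set \<Rightarrow> (ennreal ^ 'n) set" where
  "ext_set S = {u. \<exists>y\<in>S. embed y \<le> u}"

definition ext_cost :: "(real ^ 'n \<Rightarrow> real) \<Rightarrow> ennreal ^ 'n \<Rightarrow> ennreal" where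
  "ext_cost c u = (SUP y\<in>{y. 0 \<le> y \<and> embed y \<le> u}. ennreal (c y))"

definition distance :: "(real ^ 'n \<Rightarrow> real) \<Rightarrow> ennreal ^ 'n \<Rightarrow> (real ^ 'n) set \<Rightarrow> ennreal" where
  "distance c x S = (INF z\<in>{z. z \<in> ext_set S \<and> x \<le> z}. ext_cost c z - ext_cost c x)"

definition set_coord :: "ennreal ^ 'n \<Rightarrow> 'n \<Rightarrow> ennreal \<Rightarrow> ennreal ^ 'n" where
  "set_coord x j t = (\<chi> i. if i = j then t else x $ i)"

definition raises_within ::
    "(real ^ 'n \<Rightarrow> real) \<Rightarrow> ennreal ^ 'n \<Rightarrow> 'n \<Rightarrow> real \<Rightarrow> ennreal \<Rightarrow> bool" where
  "raises_within c x j \<beta> t \<longleftrightarrow>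
     x $ j \<le> t \<and> ext_cost c (set_coord x j t) - ext_cost c x \<le> ennreal \<beta>"

definition step ::
    "(real ^ 'n \<Rightarrow> real) \<Rightarrow> (real ^ 'n) set \<Rightarrow> real \<Rightarrow> ennreal ^ 'n \<Rightarrow> ennreal ^ 'n \<Rightarrow> bool" where
  "step c S \<beta> x x' \<longleftrightarrow> 0 \<le> \<beta> \<and>
     (\<forall>j\<in>vars S. raises_within c x j \<beta> (x' $ j) \<and>
        (\<forall>t. raises_within c x j \<beta> t \<longrightarrow> t \<le> x' $ j)) \<and>
     (\<forall>j. j \<notin> vars S \<longrightarrow> x' $ j = x $ j)"

text \<open>A terminating run with \<open>T\<close> calls of \<open>step\<close>: the call number \<open>t\<close> uses the violated
  constraint \<open>S t\<close> and the step size \<open>\<beta> t\<close> and leads from \<open>x t\<close> to \<open>x (Suc t)\<close>;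
  the returned vector is \<open>x T\<close>.\<close>

definition greedy_run ::
    "(real ^ 'n) set set \<Rightarrow> (real ^ 'n \<Rightarrow> real) \<Rightarrow> nat \<Rightarrow>
     (nat \<Rightarrow> ennreal ^ 'n) \<Rightarrow> (nat \<Rightarrow> (real ^ 'n) set) \<Rightarrow> (nat \<Rightarrow> real) \<Rightarrow> bool" where
  "greedy_run C c T x S \<beta> \<longleftrightarrow>
     x 0 = 0 \<and>
     (\<forall>t<T. S t \<in> C \<and> x t \<notin> ext_set (S t) \<and> step c (S t) (\<beta> t) (x t) (x (Suc t))) \<and>
     \<not> (\<exists>R\<in>C. x T \<notin> ext_set R)"

text \<open>Two hypotheses on an instance are needed for the bound \<open>c x \<le> Delta C * OPT C c\<close>.

  The cost must be continuous. Otherwise take \<open>n = 2\<close>, the cost \<open>(if x\<^sub>1 > 0 then 1 else 0) + x\<^sub>2\<close> and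
  the single constraint \<open>x\<^sub>1 \<ge> 1 \<or> x\<^sub>2 \<ge> 9/4\<close>, so that the optimum is 1. Three steps of size
  \<open>3/4\<close>, at distances 1, 1 and \<open>3/4\<close>, leave \<open>x\<^sub>1\<close> at 0 and raise \<open>x\<^sub>2\<close> to \<open>9/4\<close>; the returned
  cost \<open>9/4\<close> exceeds \<open>2 * 1\<close>.

  If no constraint depends on any coordinate, then \<open>Delta C = 0\<close> and the returned vector is 0, so
  that the bound reads \<open>c 0 \<le> 0\<close>. Hence \<open>c 0 = 0\<close> is needed in this degenerate case (only).\<close>

lemma embed_le_iff: "0 \<le> y \<Longrightarrow> 0 \<le> x \<Longrightarrow> embed y \<le> embed x \<longleftrightarrow> y \<le> x"
  by (simp add: embed_def less_eq_vec_def ennreal_le_iff)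

lemma embed_in_ext_set_iff:
  assumes "monotone_constraint S" "0 \<le> x"
  shows "embed x \<in> ext_set S \<longleftrightarrow> x \<in> S"
  using assms embed_le_iff[of _ x]
  unfolding monotone_constraint_def ext_set_def by blast

lemma ext_cost_embed:
  assumes "nondecreasing_cost c" "0 \<le> x"
  shows "ext_cost c (embed x) = ennreal (c x)"
  unfolding ext_cost_def
  using assms by (intro antisym SUP_least SUP_upper)
    (auto simp: embed_le_iff nondecreasing_cost_def intro!: ennreal_leI)

lemma ext_cost_mono: "u \<le> v \<Longrightarrow> ext_cost c u \<le> ext_cost c v"
  unfolding ext_cost_def by (rule SUP_subset_mono) (auto intro: order_trans)

lemma distance_embed:
  assumes C: "monotone_constraint S" and c: "nondecreasing_cost c"
    and nonneg: "\<And>x. 0 \<le> x \<Longrightarrow> 0 \<le> c x" and x: "0 \<le> x"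
  shows "distance c (embed x) S = (INF z\<in>{z. z \<in> S \<and> x \<le> z}. ennreal (c z - c x))"
proof -
  have real: "ext_cost c (embed z) - ext_cost c (embed x) = ennreal (c z - c x)" if "0 \<le> z" for z
    using that x c nonneg by (simp add: ext_cost_embed ennreal_minus)
  show ?thesis
    unfolding distance_def
  proof (rule antisym; rule INF_mono)
    fix z assume z: "z \<in> {z. z \<in> S \<and> x \<le> z}"
    then have "0 \<le> z" using x by (auto intro: order_trans)
    then show "\<exists>w\<in>{w. w \<in> ext_set S \<and> embed x \<le> w}.
        ext_cost c w - ext_cost c (embed x) \<le> ennreal (c z - c x)"
      using z real C x by (intro bexI[of _ "embed z"])
        (auto simp: embed_le_iff embed_in_ext_set_iff)
  next
    fix w assume w: "w \<in> {w. w \<in> ext_set S \<and> embed x \<le> w}"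
    then obtain y where y: "y \<in> S" "embed y \<le> w" by (auto simp: ext_set_def)
    have y0: "0 \<le> y" using C y by (auto simp: monotone_constraint_def)
    let ?z = "sup x y"
    have z0: "0 \<le> ?z" using x by (rule le_supI1)
    have "embed ?z $ j \<le> w $ j" for j
      using y(2) w by (auto simp: embed_def less_eq_vec_def sup_vec_def sup_max max_def)
    then have "embed ?z \<le> w" by (simp add: less_eq_vec_def)
    then have "ennreal (c ?z - c x) \<le> ext_cost c w - ext_cost c (embed x)"
      using ext_cost_mono[of "embed ?z" w c] by (simp add: real[OF z0, symmetric] ennreal_minus_mono)
    moreover have "?z \<in> S"
      using C y unfolding monotone_constraint_def by (meson sup_ge2)
    ultimately show "\<exists>z\<in>{z. z \<in> S \<and> x \<le> z}.
        ennreal (c z - c x) \<le> ext_cost c w - ext_cost c (embed x)"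
      by (intro bexI[of _ ?z]) auto
  qed
qed

end

theory Submission
  imports Defs
begin

text \<open>
  Fix a feasible vector \<open>x\<^sup>*\<close> and consider the potential \<open>c (x \<squnion> x\<^sup>*) - c x\<close>, where \<open>x\<close> is the
  current vector. A step of size \<open>\<beta>\<close> on \<open>S\<close> from \<open>x\<close> to \<open>x'\<close> raises \<open>c x\<close> by at most
  \<open>card (vars S) * \<beta>\<close>, by submodularity. It also lowers the potential by at least \<open>\<beta>\<close>: again by
  submodularity the decrease is at least \<open>c z - c x\<close> with \<open>z = x' \<sqinter> (x \<squnion> x\<^sup>*)\<close>. If \<open>x'\<^sub>k \<le> x\<^sup>*\<^sub>k\<close> for
  some \<open>k\<close> in \<open>vars S\<close>, then \<open>z\<close> dominates \<open>x\<close> with coordinate \<open>k\<close> raised to \<open>x'\<^sub>k\<close>, which costs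
  exactly \<open>\<beta>\<close> more than \<open>x\<close>; otherwise \<open>z\<close> dominates \<open>x\<^sup>*\<close> on \<open>vars S\<close>, so \<open>z\<close> satisfies \<open>S\<close> and
  \<open>\<beta>\<close> is at most the distance from \<open>x\<close> to \<open>S\<close>. Hence the step sizes add up to at most
  \<open>c x\<^sup>* - c 0\<close>.
\<close>

section \<open>Constraints and their variables\<close>

lemma card_vars_le_Delta:
  fixes C :: "(real ^ 'n) set set"
  assumes "S \<in> C"
  shows "card (vars S) \<le> Delta C"
  unfolding Delta_def
proof (rule cSUP_upper[OF assms])
  show "bdd_above ((\<lambda>S. card (vars S)) ` C)"
    by (rule bdd_aboveI[of _ "CARD('n)"]) (auto intro: card_mono)
qed

text \<open>\<open>vars\<close> only speaks of changes in a single coordinate. Since there are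
  finitely many coordinates, those outside \<open>vars S\<close> can be exchanged one by one, and
  none of these exchanges affects membership.\<close>

lemma mem_cong_on_vars:
  fixes S :: "(real ^ 'n) set"
  assumes "y \<in> S" "0 \<le> y" "0 \<le> w" "\<forall>j\<in>vars S. w $ j = y $ j"
  shows "w \<in> S"
proof -
  let ?mix = "\<lambda>J. (\<chi> i. if i \<in> J then w $ i else y $ i) :: real ^ 'n"
  have nonneg: "0 \<le> ?mix J" for J
    using assms(2,3) by (simp add: less_eq_vec_def)
  have "?mix J \<in> S" if "J \<inter> vars S = {}" for J
    using finite[of J] that
  proof (induction J rule: finite_induct)
    case empty
    then show ?case using assms(1) by simp
  next
    case (insert k J)
    have "\<forall>i. i \<noteq> k \<longrightarrow> ?mix J $ i = ?mix (insert k J) $ i"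
      by simp
    then show ?case
      using insert nonneg[of J] nonneg[of "insert k J"] unfolding vars_def by blast
  qed
  from this[of "- vars S"] have "?mix (- vars S) \<in> S"
    by simp
  moreover have "?mix (- vars S) = w"
    using assms(4) by (simp add: vec_eq_iff)
  ultimately show ?thesis by simp
qed

text \<open>Setting the irrelevant coordinates of \<open>y\<close> to 0 keeps it in \<open>S\<close>
  and puts it below \<open>z\<close> everywhere.\<close>

lemma ext_set_if_ge_on_vars:
  assumes "monotone_constraint S" "y \<in> S" "\<And>j. j \<in> vars S \<Longrightarrow> ennreal (y $ j) \<le> z $ j"
  shows "z \<in> ext_set S"
proof -
  let ?w = "\<chi> j. if j \<in> vars S then y $ j else 0"
  have y0: "0 \<le> y"
    using assms by (auto simp: monotone_constraint_def)
  have "?w \<in> S"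
    by (rule mem_cong_on_vars[OF assms(2) y0]) (use y0 in \<open>auto simp: less_eq_vec_def\<close>)
  moreover have "embed ?w \<le> z"
    using assms(3) by (simp add: embed_def less_eq_vec_def)
  ultimately show ?thesis
    by (auto simp: ext_set_def)
qed

section \<open>Submodularity of the extended cost\<close>

text \<open>The library provides \<open>inf\<close> and \<open>sup\<close> on \<open>'a ^ 'n\<close> only for Euclidean \<open>'a\<close>.\<close>

definition vmin :: "ennreal ^ 'n \<Rightarrow> ennreal ^ 'n \<Rightarrow> ennreal ^ 'n" where
  "vmin u v = (\<chi> i. min (u $ i) (v $ i))"

definition vmax :: "ennreal ^ 'n \<Rightarrow> ennreal ^ 'n \<Rightarrow> ennreal ^ 'n" where
  "vmax u v = (\<chi> i. max (u $ i) (v $ i))"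

lemma vmin_nth [simp]: "vmin u v $ i = min (u $ i) (v $ i)"
  by (simp add: vmin_def)

lemma vmax_nth [simp]: "vmax u v $ i = max (u $ i) (v $ i)"
  by (simp add: vmax_def)

lemma le_ext_cost: "0 \<le> y \<Longrightarrow> embed y \<le> u \<Longrightarrow> ennreal (c y) \<le> ext_cost c u"
  unfolding ext_cost_def by (rule SUP_upper) simp

text \<open>Real vectors \<open>a\<close> and \<open>b\<close> below the minimum and the maximum are
  dominated by the meet and the join of two real vectors lying below \<open>u\<close> and
  \<open>v\<close>. Submodularity of \<open>c\<close> applies to these two, and suprema over
  \<open>a\<close> and \<open>b\<close> finish the proof.\<close>

lemma ext_cost_submodular:
  fixes c :: "real ^ 'n \<Rightarrow> real"
  assumes "monotone_covering C c"
  shows "ext_cost c (vmin u v) + ext_cost c (vmax u v) \<le> ext_cost c u + ext_cost c v"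
proof -
  have nonneg: "0 \<le> x \<Longrightarrow> 0 \<le> c x"
    and mono: "0 \<le> x \<Longrightarrow> x \<le> y \<Longrightarrow> c x \<le> c y"
    and submod: "0 \<le> x \<Longrightarrow> 0 \<le> y \<Longrightarrow> c (inf x y) + c (sup x y) \<le> c x + c y" for x y
    using assms
    by (auto simp: monotone_covering_def nondecreasing_cost_def submodular_cost_def)
  have bound: "ennreal (c a) + ennreal (c b) \<le> ext_cost c u + ext_cost c v"
    if a: "0 \<le> a" "embed a \<le> vmin u v" and b: "0 \<le> b" "embed b \<le> vmax u v" for a b
  proof -
    \<comment> \<open>Capping \<open>w\<close> at \<open>b\<close> makes infinite coordinates real
      without losing \<open>b\<close> in the join; the maximum with \<open>a\<close> keeps the meet
      above \<open>a\<close>.\<close>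
    define cut where "cut w = (\<chi> i. max (a $ i) (enn2real (min (ennreal (b $ i)) (w $ i))))"
      for w :: "ennreal ^ 'n"
    have cut0: "0 \<le> cut w" for w
      by (simp add: cut_def less_eq_vec_def le_max_iff_disj)
    have cut_le: "embed (cut w) \<le> w" if "embed a \<le> w" for w
    proof -
      have "ennreal (cut w $ i) \<le> w $ i" for i
      proof -
        have "ennreal (enn2real (min (ennreal (b $ i)) (w $ i))) = min (ennreal (b $ i)) (w $ i)"
          by (rule ennreal_enn2real) (simp add: min_less_iff_disj)
        then show ?thesis
          using that by (auto simp: cut_def max_def embed_def less_eq_vec_def)
      qed
      then show ?thesis by (simp add: embed_def less_eq_vec_def)
    qed
    have "b $ i \<le> max (cut u $ i) (cut v $ i)" for i
    proof -
      have "ennreal (b $ i) \<le> max (u $ i) (v $ i)" "0 \<le> b $ i"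
        using b by (auto simp: embed_def less_eq_vec_def)
      then show ?thesis
        by (auto simp: cut_def max_def min_def split: if_splits)
    qed
    then have "b \<le> sup (cut u) (cut v)"
      by (simp add: less_eq_vec_def sup_vec_def sup_max)
    then have "c b \<le> c (sup (cut u) (cut v))"
      by (rule mono[OF b(1)])
    moreover have "a \<le> inf (cut u) (cut v)"
      by (simp add: less_eq_vec_def inf_vec_def cut_def)
    then have "c a \<le> c (inf (cut u) (cut v))"
      by (rule mono[OF a(1)])
    ultimately have "c a + c b \<le> c (cut u) + c (cut v)"
      using submod[OF cut0 cut0, of u v] by linarith
    then have "ennreal (c a) + ennreal (c b) \<le> ennreal (c (cut u)) + ennreal (c (cut v))"
      using nonneg a b cut0 by (simp flip: ennreal_plus)
    also have "\<dots> \<le> ext_cost c u + ext_cost c v"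
      using a(2) by (intro add_mono le_ext_cost cut0 cut_le) (auto simp: less_eq_vec_def)
    finally show ?thesis .
  qed
  have ne: "{y. 0 \<le> y \<and> embed y \<le> w} \<noteq> {}" for w :: "ennreal ^ 'n"
    by (auto simp: embed_def less_eq_vec_def intro!: exI[of _ 0])
  have "ennreal (c a) + ext_cost c (vmax u v) \<le> ext_cost c u + ext_cost c v"
    if "0 \<le> a" "embed a \<le> vmin u v" for a
    unfolding ext_cost_def[of c "vmax u v"]
    by (subst ennreal_SUP_add_right[OF ne]) (auto intro!: SUP_least bound that)
  then show ?thesis
    unfolding ext_cost_def[of c "vmin u v"]
    by (subst ennreal_SUP_add_left[OF ne, symmetric]) (auto intro!: SUP_least)
qed

section \<open>Effect of a single step\<close>

lemma raises_within_iff: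
  "ext_cost c x < top \<Longrightarrow> raises_within c x j \<beta> t \<longleftrightarrow>
     x $ j \<le> t \<and> ext_cost c (set_coord x j t) \<le> ext_cost c x + ennreal \<beta>"
  by (auto simp: raises_within_def ennreal_minus_le_iff)

text \<open>The coordinates are raised one after another. By submodularity, raising \<open>k\<close>
  after others costs at most what it costs at \<open>x\<close> itself, which is at most
  \<open>\<beta>\<close>.\<close>

lemma step_cost_le:
  fixes c :: "real ^ 'n \<Rightarrow> real"
  assumes inst: "monotone_covering C c" and fin: "ext_cost c x < top"
    and step: "step c S \<beta> x x'"
  shows "ext_cost c x' \<le> ext_cost c x + of_nat (card (vars S)) * ennreal \<beta>"
proof -
  let ?mix = "\<lambda>J. (\<chi> i. if i \<in> J then x' $ i else x $ i) :: ennreal ^ 'n"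
  have raise: "x $ k \<le> x' $ k" "ext_cost c (set_coord x k (x' $ k)) \<le> ext_cost c x + ennreal \<beta>"
    if "k \<in> vars S" for k
    using step that by (auto simp: step_def raises_within_iff[OF fin])
  have "ext_cost c (?mix J) \<le> ext_cost c x + of_nat (card J) * ennreal \<beta>" if "J \<subseteq> vars S" for J
    using finite[of J] that
  proof (induction J rule: finite_induct)
    case empty
    then show ?case by simp
  next
    case (insert k J)
    let ?r = "set_coord x k (x' $ k)"
    have k: "k \<in> vars S" and J: "J \<subseteq> vars S"
      using insert by auto
    have inf: "vmin (?mix J) ?r = x"
      using insert(2) raise(1) k J
      by (auto simp: vec_eq_iff set_coord_def min_absorb1 min_absorb2 subset_iff)
    have sup: "vmax (?mix J) ?r = ?mix (insert k J)"
      using insert(2) raise(1) k J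
      by (auto simp: vec_eq_iff set_coord_def max_absorb1 max_absorb2 subset_iff)
    have "ext_cost c x + ext_cost c (?mix (insert k J)) \<le> ext_cost c (?mix J) + ext_cost c ?r"
      using ext_cost_submodular[OF inst, of "?mix J" ?r] unfolding inf sup .
    also have "\<dots> \<le> (ext_cost c x + of_nat (card J) * ennreal \<beta>) + (ext_cost c x + ennreal \<beta>)"
      by (intro add_mono insert.IH J raise(2) k)
    also have "\<dots> = ext_cost c x + (ext_cost c x + of_nat (card (insert k J)) * ennreal \<beta>)"
      using insert(1,2) by (simp add: algebra_simps)
    finally show ?case
      using fin by (auto simp: ennreal_add_left_cancel_le)
  qed
  from this[of "vars S"] have "ext_cost c (?mix (vars S)) \<le>
      ext_cost c x + of_nat (card (vars S)) * ennreal \<beta>" by simp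
  moreover have "?mix (vars S) = x'"
    using step by (auto simp: vec_eq_iff step_def)
  ultimately show ?thesis by simp
qed

text \<open>If the raise left some of \<open>\<beta>\<close> unspent, continuity would allow a
  slightly larger finite value, contradicting the maximality of \<open>x' $ k\<close>.\<close>

lemma step_coord_tight:
  fixes c :: "real ^ 'n \<Rightarrow> real"
  assumes inst: "monotone_covering C c" and cont: "continuous_on {x. 0 \<le> x} c"
    and fin: "ext_cost c x < top" and step: "step c S \<beta> x x'"
    and k: "k \<in> vars S" "x' $ k < top"
  shows "ext_cost c x + ennreal \<beta> \<le> ext_cost c (set_coord x k (x' $ k))"
proof (rule ccontr)
  assume "\<not> ?thesis"
  then have less: "ext_cost c (set_coord x k (x' $ k)) < ext_cost c x + ennreal \<beta>"
    by simp
  define s where "s = enn2real (x' $ k)"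
  have s: "x' $ k = ennreal s" "0 \<le> s"
    using k(2) by (simp_all add: s_def)
  have \<beta>: "0 \<le> \<beta>" and ge: "x $ k \<le> ennreal s"
    and maximal: "\<And>t. raises_within c x k \<beta> t \<Longrightarrow> t \<le> ennreal s"
    using step k(1) s by (auto simp: step_def raises_within_def)
  let ?y = "\<lambda>t. axis k t :: real ^ 'n"
  have y0: "0 \<le> ?y t" if "0 \<le> t" for t
    using that by (simp add: axis_def less_eq_vec_def)
  have cost_y: "ext_cost c (embed (?y t)) = ennreal (c (?y t))" "0 \<le> c (?y t)" if "0 \<le> t" for t
    using inst y0[OF that] by (auto simp: monotone_covering_def ext_cost_embed)
  obtain e r where e: "ext_cost c (set_coord x k (x' $ k)) = ennreal e" "0 \<le> e"
    and r: "ext_cost c x = ennreal r" "0 \<le> r"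
    using less fin by (metis ennreal_cases top.not_eq_extremum not_top_less)
  have er: "e < r + \<beta>"
    using less \<beta> e r by (simp add: ennreal_less_iff flip: ennreal_plus)
  have "continuous_on {0..} (\<lambda>t. c (?y t))"
  proof (rule continuous_on_compose2[OF cont])
    show "continuous_on {0..} ?y"
      unfolding axis_def by (intro continuous_on_vec_lambda) (auto intro: continuous_on_id simp: continuous_on_def)
  qed (auto intro: y0)
  then obtain d where d: "0 < d" "\<And>t. 0 \<le> t \<Longrightarrow> dist t s < d \<Longrightarrow> dist (c (?y t)) (c (?y s)) < r + \<beta> - e"
    using s(2) er unfolding continuous_on_iff by (metis atLeast_iff diff_gt_0_iff_gt)
  define t where "t = s + d / 2"
  have t: "0 \<le> t" "s < t" "c (?y t) < c (?y s) + (r + \<beta> - e)"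
    using d(1) d(2)[of t] s(2) by (auto simp: t_def dist_real_def)
  \<comment> \<open>Raising coordinate \<open>k\<close> from \<open>s\<close> to \<open>t\<close> costs at most as much at \<open>x\<close> as at \<open>0\<close>, so only the
    continuity of the cost along the axis matters, even if coordinates of \<open>x\<close> are infinite.\<close>
  have inf: "vmin (set_coord x k (x' $ k)) (embed (?y t)) = embed (?y s)"
    using t s by (auto simp: vec_eq_iff set_coord_def embed_def axis_def min_absorb1)
  have sup: "vmax (set_coord x k (x' $ k)) (embed (?y t)) = set_coord x k (ennreal t)"
    using t s by (auto simp: vec_eq_iff set_coord_def embed_def axis_def max_absorb2 max_absorb1)
  have "ennreal (c (?y s)) + ext_cost c (set_coord x k (ennreal t)) \<le> ennreal e + ennreal (c (?y t))"
    using ext_cost_submodular[OF inst, of "set_coord x k (x' $ k)" "embed (?y t)"]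
    unfolding inf sup e by (simp add: cost_y t s)
  also have "\<dots> \<le> ennreal (c (?y s)) + ennreal (r + \<beta>)"
    using t e r \<beta> cost_y s by (simp flip: ennreal_plus)
  finally have "ext_cost c (set_coord x k (ennreal t)) \<le> ext_cost c x + ennreal \<beta>"
    using r \<beta> by (simp add: ennreal_add_left_cancel_le)
  moreover have "x $ k \<le> ennreal t"
    using ge t by (meson ennreal_leI less_imp_le order_trans)
  ultimately have "ennreal t \<le> ennreal s"
    by (intro maximal) (simp add: raises_within_iff[OF fin])
  then show False
    using t s by (simp add: ennreal_le_iff)
qed

text \<open>The drop of the potential by \<open>\<beta>\<close>, written additively to avoid
  truncated subtraction in \<open>ennreal\<close>.\<close>

lemma step_potential_decrease:
  fixes c :: "real ^ 'n \<Rightarrow> real"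
  assumes inst: "monotone_covering C c" and cont: "continuous_on {x. 0 \<le> x} c"
    and fin: "ext_cost c x < top" and step: "step c S \<beta> x x'"
    and S: "S \<in> C" and dist: "ennreal \<beta> \<le> distance c x S" and y: "y \<in> S"
  shows "ext_cost c x + ennreal \<beta> + ext_cost c (vmax x' (embed y))
    \<le> ext_cost c x' + ext_cost c (vmax x (embed y))"
proof -
  let ?z = "vmin x' (vmax x (embed y))"
  have "x $ j \<le> x' $ j" for j
    using step by (cases "j \<in> vars S") (auto simp: step_def raises_within_def)
  then have le: "x \<le> x'" by (simp add: less_eq_vec_def)
  then have xz: "x \<le> ?z" by (simp add: less_eq_vec_def le_max_iff_disj)
  have "ext_cost c x + ennreal \<beta> \<le> ext_cost c ?z"
  proof (cases "\<exists>k\<in>vars S. x' $ k \<le> ennreal (y $ k)")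
    case True
    then obtain k where k: "k \<in> vars S" "x' $ k \<le> ennreal (y $ k)" by blast
    then have "x' $ k < top" using le_less_trans by fastforce
    then have "ext_cost c x + ennreal \<beta> \<le> ext_cost c (set_coord x k (x' $ k))"
      by (rule step_coord_tight[OF inst cont fin step k(1)])
    also have "set_coord x k (x' $ k) \<le> ?z"
      using k xz by (auto simp: set_coord_def less_eq_vec_def embed_def le_max_iff_disj)
    then have "ext_cost c (set_coord x k (x' $ k)) \<le> ext_cost c ?z"
      by (rule ext_cost_mono)
    finally show ?thesis .
  next
    case False
    have "ennreal (y $ j) \<le> ?z $ j" if "j \<in> vars S" for j
      using False that by (auto simp: embed_def not_le)
    then have "?z \<in> ext_set S"
      using inst S y by (intro ext_set_if_ge_on_vars[of S y]) (auto simp: monotone_covering_def)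
    then have "distance c x S \<le> ext_cost c ?z - ext_cost c x"
      using xz unfolding distance_def by (intro INF_lower) simp
    then have "ext_cost c x + ennreal \<beta> \<le> ext_cost c x + (ext_cost c ?z - ext_cost c x)"
      using dist by (intro add_left_mono) (rule order_trans)
    also have "\<dots> = ext_cost c ?z"
      by (rule add_diff_inverse_ennreal[OF ext_cost_mono[OF xz]])
    finally show ?thesis .
  qed
  then have "ext_cost c x + ennreal \<beta> + ext_cost c (vmax x' (embed y))
      \<le> ext_cost c ?z + ext_cost c (vmax x' (embed y))"
    by (rule add_right_mono)
  \<comment> \<open>As \<open>x \<le> x'\<close>, joining with \<open>x\<close> first changes
    nothing, and submodularity fits \<open>x'\<close> and \<open>vmax x (embed y)\<close>.\<close>
  also have "\<dots> = ext_cost c ?z + ext_cost c (vmax x' (vmax x (embed y)))"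
    using le by (simp add: vmax_def less_eq_vec_def max_absorb1 flip: max.assoc)
  also have "\<dots>
      \<le> ext_cost c x' + ext_cost c (vmax x (embed y))"
    by (rule ext_cost_submodular[OF inst])
  finally show ?thesis .
qed

section \<open>Summation over the run\<close>

theorem theorem1:
  fixes C :: "(real ^ 'n) set set" and c :: "real ^ 'n \<Rightarrow> real"
    and T :: nat and x :: "nat \<Rightarrow> ennreal ^ 'n"
    and S :: "nat \<Rightarrow> (real ^ 'n) set" and \<beta> :: "nat \<Rightarrow> real"
  assumes inst: "monotone_covering C c"
    and cont: "continuous_on {x. 0 \<le> x} c"
    and nondegenerate: "0 < Delta C \<or> c 0 = 0"
    and run: "greedy_run C c T x S \<beta>"
    and step_size: "\<forall>t<T. ennreal (\<beta> t) \<le> distance c (x t) (S t)"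
  shows "(\<forall>R\<in>C. x T \<in> ext_set R) \<and> ext_cost c (x T) \<le> of_nat (Delta C) * OPT C c"
proof
  show "\<forall>R\<in>C. x T \<in> ext_set R"
    using run by (auto simp: greedy_run_def)
  let ?E = "ext_cost c"
  define B where "B t = (\<Sum>i<t. ennreal (\<beta> i))" for t
  have B_Suc: "B (Suc t) = B t + ennreal (\<beta> t)" for t
    by (simp add: B_def)
  have B_fin: "B t < top" for t
    by (simp add: B_def)
  have x0: "x 0 = embed 0"
    using run by (simp add: greedy_run_def embed_def vec_eq_iff)
  have E0: "?E (x 0) = ennreal (c 0)"
    using inst by (simp add: x0 ext_cost_embed monotone_covering_def)
  have S: "S t \<in> C" and step: "step c (S t) (\<beta> t) (x t) (x (Suc t))" if "t < T" for t
    using run that by (auto simp: greedy_run_def)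
  \<comment> \<open>Finiteness is carried along because cancellation in \<open>ennreal\<close>
    requires it.\<close>
  have cost: "?E (x t) \<le> ennreal (c 0) + of_nat (Delta C) * B t \<and> ?E (x t) < top" if "t \<le> T" for t
    using that
  proof (induction t)
    case 0
    then show ?case by (simp add: E0)
  next
    case (Suc t)
    then have t: "t < T" and IH: "?E (x t) \<le> ennreal (c 0) + of_nat (Delta C) * B t" "?E (x t) < top"
      by auto
    have "?E (x (Suc t)) \<le> ?E (x t) + of_nat (card (vars (S t))) * ennreal (\<beta> t)"
      by (rule step_cost_le[OF inst IH(2) step[OF t]])
    also have "\<dots> \<le> (ennreal (c 0) + of_nat (Delta C) * B t) + of_nat (Delta C) * ennreal (\<beta> t)"
      by (intro add_mono IH(1) mult_right_mono) (simp_all add: card_vars_le_Delta S[OF t])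
    finally have "?E (x (Suc t)) \<le> ennreal (c 0) + of_nat (Delta C) * B (Suc t)"
      by (simp add: B_Suc algebra_simps)
    moreover have "ennreal (c 0) + of_nat (Delta C) * B (Suc t) < top"
      using B_fin[of "Suc t"] by (simp add: ennreal_mult_less_top of_nat_less_top)
    ultimately show ?case
      by (meson le_less_trans)
  qed
  have sum_le: "B T + ennreal (c 0) \<le> ennreal (c y)" if y: "feasible C y" for y
  proof -
    \<comment> \<open>Invariant: the step sizes so far plus the current potential are at most the
      initial potential \<open>c y - c 0\<close>.\<close>
    have "B t + ?E (vmax (x t) (embed y)) + ennreal (c 0) \<le> ?E (x t) + ennreal (c y)" if "t \<le> T" for t
      using that
    proof (induction t)
      case 0
      have "0 \<le> y" using y by (simp add: feasible_def)
      then have "embed 0 \<le> embed y" by (simp add: embed_le_iff)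
      then have "vmax (embed 0) (embed y) = embed y"
        by (simp add: vec_eq_iff less_eq_vec_def max_absorb2)
      then show ?case
        using inst \<open>0 \<le> y\<close> E0
        by (simp add: x0 B_def ext_cost_embed monotone_covering_def add.commute)
    next
      case (Suc t)
      then have t: "t < T" by simp
      have fin: "?E (x t) < top" using cost t by simp
      have "?E (x t) + (B (Suc t) + ?E (vmax (x (Suc t)) (embed y)) + ennreal (c 0))
          = (?E (x t) + ennreal (\<beta> t) + ?E (vmax (x (Suc t)) (embed y))) + (B t + ennreal (c 0))"
        by (simp add: B_Suc ac_simps)
      also have "\<dots> \<le> (?E (x (Suc t)) + ?E (vmax (x t) (embed y))) + (B t + ennreal (c 0))"
        using y S[OF t] step_size t
        by (intro add_right_mono step_potential_decrease[OF inst cont fin step[OF t]])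
          (auto simp: feasible_def)
      also have "\<dots> = (B t + ?E (vmax (x t) (embed y)) + ennreal (c 0)) + ?E (x (Suc t))"
        by (simp add: ac_simps)
      also have "\<dots> \<le> (?E (x t) + ennreal (c y)) + ?E (x (Suc t))"
        using Suc by (intro add_right_mono) simp
      also have "\<dots> = ?E (x t) + (?E (x (Suc t)) + ennreal (c y))"
        by (simp add: ac_simps)
      finally show ?case
        using fin by (auto simp: ennreal_add_left_cancel_le)
    qed
    from this[of T] have "B T + ?E (vmax (x T) (embed y)) + ennreal (c 0) \<le> ?E (x T) + ennreal (c y)"
      by simp
    moreover have "?E (x T) \<le> ?E (vmax (x T) (embed y))"
      by (rule ext_cost_mono) (simp add: less_eq_vec_def)
    then have "?E (x T) + (B T + ennreal (c 0)) \<le> B T + ?E (vmax (x T) (embed y)) + ennreal (c 0)"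
      by (simp add: ac_simps add_left_mono)
    ultimately have "?E (x T) + (B T + ennreal (c 0)) \<le> ?E (x T) + ennreal (c y)"
      by (rule order_trans[rotated])
    then show ?thesis
      using cost[of T] by (auto simp: ennreal_add_left_cancel_le)
  qed
  show "?E (x T) \<le> of_nat (Delta C) * OPT C c"
  proof (cases "Delta C = 0")
    case True
    then show ?thesis
      using cost[of T] nondegenerate by simp
  next
    case False
    have "B T + ennreal (c 0) \<le> OPT C c"
      unfolding OPT_def by (rule INF_greatest) (simp add: sum_le)
    have "?E (x T) \<le> ennreal (c 0) + of_nat (Delta C) * B T"
      using cost by simp
    \<comment> \<open>Here \<open>Delta C \<ge> 1\<close> absorbs the starting cost
      \<open>c 0\<close> into the factor.\<close>
    also have "\<dots> \<le> of_nat (Delta C) * ennreal (c 0) + of_nat (Delta C) * B T"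
      using False mult_right_mono[of 1 "of_nat (Delta C)" "ennreal (c 0)"]
      by (intro add_right_mono) (simp add: Suc_le_eq)
    also have "\<dots> = of_nat (Delta C) * (B T + ennreal (c 0))"
      by (simp add: algebra_simps)
    also have "\<dots> \<le> of_nat (Delta C) * OPT C c"
      by (rule mult_left_mono) (use \<open>B T + ennreal (c 0) \<le> OPT C c\<close> in simp_all)
    finally show ?thesis .
  qed
qed

end
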